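(* Let $N\ge 2$ be even and let $f:\{0,1\}^N\to\{0,1\}$ be PARITY, i.e. $f(X)=1$ if and only if the number of 1s in $X$ is odd. Then $Q_E(f)=Q_0(f)=Q_2(f)=N/2$.
   Context: Quantum networks: the input $X=(x_0,\ldots,x_{N-1})\in\{0,1\}^N$ is given as a black-box. A quantum network with $T$ queries acts on $m$ qubits (for some $m$) and is a sequence of unitary transformations $U_0,O,U_1,O,\ldots,U_{T-1},O,U_T$ applied in this order to the initial state $|0\rangle$, where the $U_j$ are arbitrary unitaries on $m$ qubits not depending on $X$, and the query $O$ (depending on $X$) maps each basis state $|i,b,z\rangle$ to $|i,b\oplus x_i,z\rangle$; here $i$ consists of $\lceil\log_2 N\rceil$ bits, $b$ is one bit, and $z$ consists of the remaining $m-\lceil\log_2 N\rceil-1$ bits (if $i\ge N$, the query leaves the basis state unchanged). In the exact and bounded-error settings the output is the value obtained by measuring the rightmost bit of the final state in the computational basis. The network computes $f$ exactly if for every $X\in\{0,1\}^N$ the output equals $f(X)$ with certainty, and with bounded error if for every $X$ the output equals $f(X)$ with probability at least $2/3$. Zero-error computation: the output is obtained by measuring the two rightmost bits of the final state. If the first of these two bits is 0 the answer is "inconclusive"; otherwise the second bit is the answer. The network computes $f$ with zero error if for every $X$ the answer, whenever it is not "inconclusive", equals $f(X)$ with certainty, and the probability of "inconclusive" is less than $1/2$. $Q_E(f)$, $Q_0(f)$, $Q_2(f)$ are the minimum $T$ such that some quantum network with $T$ queries computes $f$ exactly, with zero error, and with bounded error, respectively. *)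

theory Defs
  imports
    Complex_Main
    "HOL-Library.Extended_Nat"
    "Jordan_Normal_Form.Schur_Decomposition"
begin

text \<open>
  An input in \<open>{0,1}\<^sup>N\<close> is a Boolean list \<open>X\<close> with \<open>length X = N\<close>, and \<open>x\<^sub>i = X ! i\<close>.

  A state of \<open>m\<close> qubits is a complex vector of dimension \<open>2 ^ m\<close>. The basis state
  whose bits, read from left to right, are the binary digits of \<open>k\<close> (most significant
  first) is \<open>unit_vec (2 ^ m) k\<close>; so the rightmost bit of \<open>k\<close> is its parity.
\<close>

definition index_bits :: "nat \<Rightarrow> nat" where
  "index_bits N = nat \<lceil>log 2 (real N)\<rceil>"

text \<open>
  The basis state \<open>|i,b,z\<rangle>\<close> has the number \<open>i * 2 ^ (w + 1) + b * 2 ^ w + z\<close>, where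
  \<open>w = m - index_bits N - 1\<close> is the number of bits of \<open>z\<close>.
\<close>

definition query_index :: "nat \<Rightarrow> bool list \<Rightarrow> nat \<Rightarrow> nat" where
  "query_index m X k =
    (let w = m - index_bits (length X) - 1; i = k div 2 ^ (w + 1)
     in if i < length X \<and> X ! i then flip_bit w k else k)"

lemma query_index_basis_state:
  fixes i b z m :: nat and X :: "bool list"
  defines "w \<equiv> m - index_bits (length X) - 1"
  assumes "b < 2" "z < 2 ^ w"
  shows "query_index m X (i * 2 ^ (w + 1) + b * 2 ^ w + z) =
    i * 2 ^ (w + 1) + (if i < length X \<and> X ! i then 1 - b else b) * 2 ^ w + z"
proof -
  let ?k = "i * 2 ^ (w + 1) + b * 2 ^ w + z"
  have k: "?k = (2 * i + b) * 2 ^ w + z"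
    by (simp add: algebra_simps)
  have d: "?k div 2 ^ w = 2 * i + b"
    unfolding k using assms(3) by simp
  have i: "?k div 2 ^ (w + 1) = i"
  proof -
    have "?k div 2 ^ (w + 1) = ?k div 2 ^ w div 2"
      by (metis div_mult2_eq power_add power_one_right)
    then show ?thesis
      unfolding d using assms(2) by simp
  qed
  have flip0: "flip_bit w (i * 2 ^ (w + 1) + z) = i * 2 ^ (w + 1) + 2 ^ w + z"
  proof -
    have "(i * 2 ^ (w + 1) + z) div 2 ^ w = 2 * i"
      using assms(3) by (simp add: mult.assoc[symmetric])
    then have "\<not> bit (i * 2 ^ (w + 1) + z) w"
      unfolding bit_iff_odd by simp
    then show ?thesis
      by (simp add: flip_bit_eq_if set_bit_eq)
  qed
  have flip_flip: "flip_bit w (flip_bit w n) = n" for n :: nat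
    by (rule bit_eqI) (auto simp: bit_flip_bit_iff)
  have "flip_bit w ?k = i * 2 ^ (w + 1) + (1 - b) * 2 ^ w + z"
    using assms(2) flip0 flip_flip[of "i * 2 ^ (w + 1) + z"]
    by (auto simp: less_2_cases_iff)
  then show ?thesis
    unfolding query_index_def Let_def w_def[symmetric] i by simp
qed

definition query_mat :: "nat \<Rightarrow> bool list \<Rightarrow> complex mat" where
  "query_mat m X =
    mat (2 ^ m) (2 ^ m) (\<lambda>(r, c). if r = query_index m X c then 1 else 0)"

definition unitary_mat :: "nat \<Rightarrow> complex mat \<Rightarrow> bool" where
  "unitary_mat d U \<longleftrightarrow> U \<in> carrier_mat d d \<and>
    mat_adjoint U * U = 1\<^sub>m d \<and> U * mat_adjoint U = 1\<^sub>m d"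

text \<open>
  The network applies \<open>U 0, O, U 1, O, \<dots>, O, U T\<close>. The values \<open>U j\<close> with \<open>j > T\<close> are
  irrelevant. The register must have room for \<open>i\<close> and \<open>b\<close>.
\<close>

definition quantum_network :: "nat \<Rightarrow> nat \<Rightarrow> nat \<Rightarrow> (nat \<Rightarrow> complex mat) \<Rightarrow> bool" where
  "quantum_network N m T U \<longleftrightarrow>
    index_bits N + 1 \<le> m \<and> (\<forall>j\<le>T. unitary_mat (2 ^ m) (U j))"

primrec final_state ::
  "nat \<Rightarrow> (nat \<Rightarrow> complex mat) \<Rightarrow> bool list \<Rightarrow> nat \<Rightarrow> complex vec" where
  "final_state m U X 0 = U 0 *\<^sub>v unit_vec (2 ^ m) 0"
| "final_state m U X (Suc t) = U (Suc t) *\<^sub>v (query_mat m X *\<^sub>v final_state m U X t)"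

text \<open>
  The probability that measuring \<open>v\<close> in the computational basis yields a basis state
  whose number satisfies \<open>P\<close>.
\<close>

definition measure_prob :: "complex vec \<Rightarrow> (nat \<Rightarrow> bool) \<Rightarrow> real" where
  "measure_prob v P = (\<Sum>k | k < dim_vec v \<and> P k. (cmod (v $ k))\<^sup>2)"

definition computes_exactly ::
  "nat \<Rightarrow> nat \<Rightarrow> nat \<Rightarrow> (nat \<Rightarrow> complex mat) \<Rightarrow> (bool list \<Rightarrow> bool) \<Rightarrow> bool" where
  "computes_exactly N m T U f \<longleftrightarrow>
    (\<forall>X. length X = N \<longrightarrow> measure_prob (final_state m U X T) (\<lambda>k. bit k 0 = f X) = 1)"

definition computes_bounded_error ::
  "nat \<Rightarrow> nat \<Rightarrow> nat \<Rightarrow> (nat \<Rightarrow> complex mat) \<Rightarrow> (bool list \<Rightarrow> bool) \<Rightarrow> bool" where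
  "computes_bounded_error N m T U f \<longleftrightarrow>
    (\<forall>X. length X = N \<longrightarrow> measure_prob (final_state m U X T) (\<lambda>k. bit k 0 = f X) \<ge> 2 / 3)"

text \<open>
  Of the two rightmost bits, the first (left) one is bit 1 and the second one is bit 0.
  The condition \<open>2 \<le> m\<close> only matters for \<open>N \<le> 1\<close>.
\<close>

definition computes_zero_error ::
  "nat \<Rightarrow> nat \<Rightarrow> nat \<Rightarrow> (nat \<Rightarrow> complex mat) \<Rightarrow> (bool list \<Rightarrow> bool) \<Rightarrow> bool" where
  "computes_zero_error N m T U f \<longleftrightarrow> 2 \<le> m \<and>
    (\<forall>X. length X = N \<longrightarrow>
      measure_prob (final_state m U X T) (\<lambda>k. bit k 1 \<and> bit k 0 \<noteq> f X) = 0 \<and>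
      measure_prob (final_state m U X T) (\<lambda>k. \<not> bit k 1) < 1 / 2)"

text \<open>
  The minimum is taken in \<^typ>\<open>enat\<close>, so that it is \<open>\<infinity>\<close> (rather than an unspecified
  number) if no network computes \<open>f\<close>.
\<close>

definition Q_E :: "nat \<Rightarrow> (bool list \<Rightarrow> bool) \<Rightarrow> enat" where
  "Q_E N f = Inf {enat T | T. \<exists>m U. quantum_network N m T U \<and> computes_exactly N m T U f}"

definition Q_0 :: "nat \<Rightarrow> (bool list \<Rightarrow> bool) \<Rightarrow> enat" where
  "Q_0 N f = Inf {enat T | T. \<exists>m U. quantum_network N m T U \<and> computes_zero_error N m T U f}"

definition Q_2 :: "nat \<Rightarrow> (bool list \<Rightarrow> bool) \<Rightarrow> enat" where
  "Q_2 N f = Inf {enat T | T. \<exists>m U. quantum_network N m T U \<and> computes_bounded_error N m T U f}"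

end

theory Submission
  imports Defs
begin

text \<open>
  Lower bound (polynomial method): one query lets an amplitude depend on one more input bit, so
  after \<open>T\<close> queries every amplitude is a sum of functions of at most \<open>T\<close> bits of the input, and
  every acceptance probability is a sum of functions of at most \<open>2 * T\<close> bits. If \<open>2 * T < N\<close>, such
  a function has the same sum over the inputs of even parity as over those of odd parity, so it
  cannot be large exactly on the latter.

  Upper bound: Deutsch's algorithm finds the parity of two bits with one query and stores it in the
  sign of a two-term superposition. Moving this superposition to the next pair of indices before
  the next query accumulates the parity of all pairs in that sign.
\<close>

section \<open>Unitary matrices\<close>

lemma adjoint_mult_index:
  assumes "U \<in> carrier_mat d d" "i < d" "j < d"
  shows "(mat_adjoint U * U) $$ (i, j) = (\<Sum>k<d. cnj (U $$ (k, i)) * U $$ (k, j))"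
  using assms by (simp add: mat_adjoint_def scalar_prod_def lessThan_atLeast0)

text \<open>For square matrices a left inverse is also a right inverse, so orthonormal columns
  suffice. The later unitarity proofs rest on this entrywise form.\<close>

lemma unitary_mat_iff:
  "unitary_mat d U \<longleftrightarrow> U \<in> carrier_mat d d \<and>
    (\<forall>i<d. \<forall>j<d. (\<Sum>k<d. cnj (U $$ (k, i)) * U $$ (k, j)) = (if i = j then 1 else 0))"
    (is "_ \<longleftrightarrow> _ \<and> ?orth")
proof (cases "U \<in> carrier_mat d d")
  case True
  have adj: "mat_adjoint U \<in> carrier_mat d d"
    using carrier_matD[OF True] by (intro carrier_matI) (simp_all add: mat_adjoint_def)
  have "mat_adjoint U * U = 1\<^sub>m d \<longleftrightarrow>
      (\<forall>i<d. \<forall>j<d. (mat_adjoint U * U) $$ (i, j) = (1\<^sub>m d :: complex mat) $$ (i, j))"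
    using carrier_matD[OF True] carrier_matD[OF adj] by (simp only: mat_eq_iff) simp
  also have "\<dots> \<longleftrightarrow> ?orth"
    using adjoint_mult_index[OF True] by (simp del: index_mult_mat(1))
  finally have "mat_adjoint U * U = 1\<^sub>m d \<longleftrightarrow> ?orth" .
  then show ?thesis
    unfolding unitary_mat_def using mat_mult_left_right_inverse[OF adj True] True by blast
qed (simp add: unitary_mat_def)

lemma unitary_mat_mult:
  assumes "unitary_mat d A" "unitary_mat d B"
  shows "unitary_mat d (A * B)"
proof -
  have A: "A \<in> carrier_mat d d" and B: "B \<in> carrier_mat d d"
    using assms by (auto simp: unitary_mat_def)
  have A1: "(\<Sum>k<d. cnj (A $$ (k, i)) * A $$ (k, j)) = (if i = j then 1 else 0)"
    if "i < d" "j < d" for i j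
    using assms(1) that by (simp add: unitary_mat_iff)
  have "(\<Sum>k<d. cnj ((A * B) $$ (k, i)) * (A * B) $$ (k, j)) = (if i = j then 1 else 0)"
    if ij: "i < d" "j < d" for i j
  proof -
    have "(\<Sum>k<d. cnj ((A * B) $$ (k, i)) * (A * B) $$ (k, j)) =
      (\<Sum>k<d. \<Sum>p<d. \<Sum>q<d. cnj (B $$ (p, i)) * B $$ (q, j) * (cnj (A $$ (k, p)) * A $$ (k, q)))"
      using A B ij
      by (intro sum.cong refl, simp add: scalar_prod_def lessThan_atLeast0 sum_product)
        (simp add: mult_ac)
    \<comment> \<open>Moving the sum over \<open>k\<close> innermost isolates the inner product of
      columns \<open>p\<close> and \<open>q\<close> of \<open>A\<close>.\<close>
    also have "\<dots> = (\<Sum>p<d. \<Sum>q<d. cnj (B $$ (p, i)) * B $$ (q, j) *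
        (\<Sum>k<d. cnj (A $$ (k, p)) * A $$ (k, q)))"
      unfolding sum_distrib_left
      by (subst sum.swap, rule sum.cong[OF refl], subst sum.swap, rule refl)
    also have "\<dots> = (\<Sum>p<d. cnj (B $$ (p, i)) * B $$ (p, j))"
      by (intro sum.cong) (simp_all add: A1 if_distrib cong: if_cong)
    also have "\<dots> = (if i = j then 1 else 0)"
      using assms(2) ij by (simp add: unitary_mat_iff)
    finally show ?thesis .
  qed
  then show ?thesis
    using A B by (simp add: unitary_mat_iff)
qed

text \<open>Orthonormal columns collapse the double sum for the squared norm to its diagonal. This
  is why the outcome probabilities of a network add up to 1.\<close>

lemma unitary_mat_norm:
  assumes "unitary_mat d U" "v \<in> carrier_vec d"
  shows "(\<Sum>k<d. (cmod ((U *\<^sub>v v) $ k))\<^sup>2) = (\<Sum>k<d. (cmod (v $ k))\<^sup>2)"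
proof -
  have U: "U \<in> carrier_mat d d"
    using assms by (simp add: unitary_mat_def)
  have U1: "(\<Sum>k<d. cnj (U $$ (k, i)) * U $$ (k, j)) = (if i = j then 1 else 0)"
    if "i < d" "j < d" for i j
    using assms(1) that by (simp add: unitary_mat_iff)
  have "complex_of_real (\<Sum>k<d. (cmod ((U *\<^sub>v v) $ k))\<^sup>2) =
      (\<Sum>k<d. cnj ((U *\<^sub>v v) $ k) * (U *\<^sub>v v) $ k)"
    by (simp only: of_real_sum complex_norm_square mult.commute)
  also have "\<dots> = (\<Sum>k<d. \<Sum>p<d. \<Sum>q<d. cnj (v $ p) * v $ q * (cnj (U $$ (k, p)) * U $$ (k, q)))"
    using U assms(2)
    by (intro sum.cong refl, simp add: scalar_prod_def lessThan_atLeast0 sum_product)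
      (simp add: mult_ac)
  also have "\<dots> = (\<Sum>p<d. \<Sum>q<d. cnj (v $ p) * v $ q * (\<Sum>k<d. cnj (U $$ (k, p)) * U $$ (k, q)))"
    unfolding sum_distrib_left
    by (subst sum.swap, rule sum.cong[OF refl], subst sum.swap, rule refl)
  also have "\<dots> = (\<Sum>p<d. cnj (v $ p) * v $ p)"
    by (intro sum.cong) (simp_all add: U1 if_distrib cong: if_cong)
  also have "\<dots> = complex_of_real (\<Sum>k<d. (cmod (v $ k))\<^sup>2)"
    by (simp only: of_real_sum complex_norm_square mult.commute)
  finally show ?thesis
    by (simp only: of_real_eq_iff)
qed

section \<open>Permutation matrices\<close>

definition perm_mat :: "nat \<Rightarrow> (nat \<Rightarrow> nat) \<Rightarrow> complex mat" where
  "perm_mat d p = mat d d (\<lambda>(r, c). if r = p c then 1 else 0)"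

lemma perm_mat_carrier [simp]: "perm_mat d p \<in> carrier_mat d d"
  by (simp add: perm_mat_def)

lemma unitary_perm_mat:
  assumes "bij_betw p {..<d} {..<d}"
  shows "unitary_mat d (perm_mat d p)"
proof -
  have "(\<Sum>k<d. cnj (perm_mat d p $$ (k, i)) * perm_mat d p $$ (k, j)) = (if i = j then 1 else 0)"
    if "i < d" "j < d" for i j
  proof -
    have "p i < d" "p i = p j \<longleftrightarrow> i = j"
      using assms that bij_betwE[OF assms] inj_on_eq_iff[OF bij_betw_imp_inj_on[OF assms]] by auto
    moreover have "(\<Sum>k<d. cnj (perm_mat d p $$ (k, i)) * perm_mat d p $$ (k, j)) =
        (\<Sum>k<d. if k = p i then (if p i = p j then 1 else 0) else 0)"
      using that by (intro sum.cong) (auto simp: perm_mat_def)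
    ultimately show ?thesis
      by simp
  qed
  then show ?thesis
    by (simp add: unitary_mat_iff)
qed

text \<open>Every row is \<open>p k\<close> for some \<open>k\<close>, so testing \<open>w\<close>
  at the points \<open>p k\<close> suffices and no inverse of \<open>p\<close> has to be
  named.\<close>

lemma perm_mat_mult_vec_eqI:
  assumes "bij_betw p {..<d} {..<d}" "v \<in> carrier_vec d" "w \<in> carrier_vec d"
    and "\<And>k. k < d \<Longrightarrow> w $ p k = v $ k"
  shows "perm_mat d p *\<^sub>v v = w"
proof (rule eq_vecI)
  fix r assume "r < dim_vec w"
  then have r: "r < d"
    using assms(3) by simp
  obtain k where k: "k < d" "r = p k"
    using r assms(1) unfolding bij_betw_def by auto
  have "(perm_mat d p *\<^sub>v v) $ r = (\<Sum>c<d. (if p k = p c then 1 else 0) * v $ c)"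
    using r k assms(2)
    by (simp add: perm_mat_def scalar_prod_def lessThan_atLeast0)
  also have "\<dots> = (\<Sum>c<d. if c = k then v $ c else 0)"
    using k inj_on_eq_iff[OF bij_betw_imp_inj_on[OF assms(1)]] by (intro sum.cong) auto
  also have "\<dots> = w $ r"
    using k assms(4) by simp
  finally show "(perm_mat d p *\<^sub>v v) $ r = w $ r" .
qed (use assms in \<open>simp_all add: perm_mat_def\<close>)

section \<open>The query as a permutation of basis states\<close>

lemma query_mat_eq_perm_mat: "query_mat m X = perm_mat (2 ^ m) (query_index m X)"
  by (simp add: query_mat_def perm_mat_def)

text \<open>Flipping bit \<open>w\<close> leaves the quotient by \<open>2 ^ (w + 1)\<close>, and so
  the queried index, unchanged; a second application therefore makes the same decision and undoes
  the flip.\<close>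

lemma query_index_involution: "query_index m X (query_index m X k) = k"
proof -
  define w where "w = m - index_bits (length X) - 1"
  have div: "flip_bit w k div 2 ^ (w + 1) = k div 2 ^ (w + 1)"
    unfolding drop_bit_eq_div[symmetric]
    by (rule bit_eqI) (simp add: bit_drop_bit_eq bit_flip_bit_iff)
  have "flip_bit w (flip_bit w k) = k"
    by (rule bit_eqI) (auto simp: bit_flip_bit_iff)
  then show ?thesis
    using div unfolding query_index_def Let_def w_def[symmetric]
    by (smt (verit))
qed

lemma query_index_less:
  assumes "index_bits (length X) + 1 \<le> m" "k < 2 ^ m"
  shows "query_index m X k < 2 ^ m"
proof -
  define w where "w = m - index_bits (length X) - 1"
  have "w < m"
    using assms by (simp add: w_def)
  then have "flip_bit w k < 2 ^ m"
    using assms(2)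
    by (metis (no_types, lifting) take_bit_nat_eq_self_iff take_bit_flip_bit_eq not_le)
  then show ?thesis
    unfolding query_index_def Let_def w_def[symmetric] using assms by simp
qed

lemma bij_betw_query_index:
  assumes "index_bits (length X) + 1 \<le> m"
  shows "bij_betw (query_index m X) {..<2 ^ m} {..<2 ^ m}"
  by (rule bij_betw_byWitness[where f' = "query_index m X"])
    (use assms in \<open>auto simp: query_index_involution query_index_less\<close>)

section \<open>Sums of juntas\<close>

text \<open>\<open>S\<close> may contain positions beyond the list. This is harmless, because
  updating a list at one position leaves \<open>X ! i\<close> unchanged at every other
  \<open>i\<close>, in range or not.\<close>

definition depends_only_on :: "nat \<Rightarrow> nat set \<Rightarrow> (bool list \<Rightarrow> 'a) \<Rightarrow> bool" where
  "depends_only_on N S g \<longleftrightarrow>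
    (\<forall>X Y. length X = N \<and> length Y = N \<and> (\<forall>i\<in>S. X ! i = Y ! i) \<longrightarrow> g X = g Y)"

text \<open>On inputs of length \<open>N\<close> these are exactly the polynomials of degree at most
  \<open>d\<close> in the input bits. Sums of juntas replace monomials and coefficients.\<close>

inductive junta_sum :: "nat \<Rightarrow> nat \<Rightarrow> (bool list \<Rightarrow> complex) \<Rightarrow> bool" for N d where
  junta: "finite S \<Longrightarrow> card S \<le> d \<Longrightarrow> depends_only_on N S g \<Longrightarrow> junta_sum N d g"
| add: "junta_sum N d g \<Longrightarrow> junta_sum N d h \<Longrightarrow> junta_sum N d (\<lambda>X. g X + h X)"

lemma junta_sum_const: "junta_sum N d (\<lambda>X. c)"
  by (rule junta[of "{}"]) (simp_all add: depends_only_on_def)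

lemma junta_sum_sum:
  "finite A \<Longrightarrow> (\<And>a. a \<in> A \<Longrightarrow> junta_sum N d (g a)) \<Longrightarrow> junta_sum N d (\<lambda>X. \<Sum>a\<in>A. g a X)"
  by (induction A rule: finite_induct) (auto intro: junta_sum_const add)

text \<open>Multiplying each summand of \<open>h\<close> by the single junta \<open>g\<close> unites
  two supports, so their sizes add up at most.\<close>

lemma junta_sum_mult_junta:
  assumes "junta_sum N e h" "finite S" "card S \<le> d" "depends_only_on N S g"
  shows "junta_sum N (d + e) (\<lambda>X. g X * h X)"
  using assms(1)
proof induction
  case (junta S' h)
  show ?case
  proof (rule junta_sum.junta)
    show "card (S \<union> S') \<le> d + e"
      using card_Un_le[of S S'] assms(3) junta(2) by linarith
    show "depends_only_on N (S \<union> S') (\<lambda>X. g X * h X)"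
      unfolding depends_only_on_def
    proof (intro allI impI)
      fix X Y :: "bool list"
      assume "length X = N \<and> length Y = N \<and> (\<forall>i\<in>S \<union> S'. X ! i = Y ! i)"
      then have "g X = g Y" "h X = h Y"
        using assms(4) junta(3) unfolding depends_only_on_def by blast+
      then show "g X * h X = g Y * h Y"
        by simp
    qed
  qed (use assms junta in simp)
next
  case (add h h')
  then show ?case
    using junta_sum.add[of N "d + e"] by (simp add: distrib_left)
qed

lemma junta_sum_mult:
  assumes "junta_sum N d g" "junta_sum N e h"
  shows "junta_sum N (d + e) (\<lambda>X. g X * h X)"
  using assms(1)
proof induction
  case (junta S g)
  then show ?case
    using junta_sum_mult_junta assms(2) by blast
next
  case (add g g')
  then show ?case
    using junta_sum.add[of N "d + e"] by (simp add: distrib_right)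
qed

lemma junta_sum_cnj:
  assumes "junta_sum N d g"
  shows "junta_sum N d (\<lambda>X. cnj (g X))"
  using assms
proof induction
  case (junta S g)
  then show ?case
    by (intro junta_sum.junta[of S]) (auto simp: depends_only_on_def intro!: arg_cong[of _ _ cnj])
next
  case (add g h)
  then show ?case
    using junta_sum.add by simp
qed

lemma even_count_list_flip:
  "i < length X \<Longrightarrow> even (count_list (X[i := \<not> X ! i]) True) \<longleftrightarrow> odd (count_list X True)"
proof (induction X arbitrary: i)
  case (Cons x X)
  then show ?case
    by (cases i) auto
qed simp

text \<open>Flipping a coordinate on which a junta does not depend pairs off opposite terms.\<close>

lemma junta_sum_parity_orthogonal:
  assumes "junta_sum N d g" "d < N"
  shows "(\<Sum>X | length X = N. (- 1) ^ count_list X True * g X) = 0"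
  using assms(1)
proof induction
  case (junta S g)
  \<comment> \<open>\<open>card S \<le> d < N\<close> leaves a position below \<open>N\<close>
    outside \<open>S\<close>.\<close>
  obtain i where i: "i < N" "i \<notin> S"
    using junta(1,2) assms(2) card_mono[of S "{..<N}"] by force
  define flip where "flip X = X[i := \<not> X ! i]" for X :: "bool list"
  have flip: "length (flip X) = N" "flip (flip X) = X" "g (flip X) = g X"
    "(- 1) ^ count_list (flip X) True = - ((- 1) ^ count_list X True :: complex)"
    if "length X = N" for X
  proof -
    show "length (flip X) = N" "flip (flip X) = X"
      using that i by (simp_all add: flip_def)
    show "g (flip X) = g X"
      using junta(3) that i unfolding depends_only_on_def flip_def
      by (metis length_list_update nth_list_update_neq)
    show "(- 1) ^ count_list (flip X) True = - ((- 1) ^ count_list X True :: complex)"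
      using even_count_list_flip[of i X] that i unfolding flip_def
      by (auto simp: uminus_power_if)
  qed
  have "(\<Sum>X | length X = N. (- 1) ^ count_list X True * g X) =
      (\<Sum>X | length X = N. - ((- 1) ^ count_list X True * g X))"
    by (rule sum.reindex_bij_witness[of _ flip flip]) (auto simp: flip)
  then show ?case
    by (simp add: sum_negf)
qed (simp add: distrib_left sum.distrib)

section \<open>The lower bound\<close>

lemma final_state_carrier:
  assumes "quantum_network N m T U" "t \<le> T"
  shows "final_state m U X t \<in> carrier_vec (2 ^ m)"
proof -
  have "U t \<in> carrier_mat (2 ^ m) (2 ^ m)"
    using assms by (simp add: quantum_network_def unitary_mat_def)
  then show ?thesis
    by (cases t) (auto intro!: carrier_vecI)
qed

lemma final_state_norm:
  assumes "quantum_network N m T U" "t \<le> T" "length X = N"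
  shows "(\<Sum>k<2 ^ m. (cmod (final_state m U X t $ k))\<^sup>2) = 1"
  using assms(2)
proof (induction t)
  case 0
  have "(\<Sum>k<2 ^ m. (cmod (final_state m U X 0 $ k))\<^sup>2) =
      (\<Sum>k<2 ^ m. (cmod ((unit_vec (2 ^ m) 0 :: complex vec) $ k))\<^sup>2)"
    using assms(1) by (simp add: unitary_mat_norm quantum_network_def)
  also have "\<dots> = (\<Sum>k<(2::nat) ^ m. if k = 0 then 1 else 0)"
    by (intro sum.cong) (auto simp: unit_vec_def)
  finally show ?case
    by simp
next
  case (Suc t)
  have v: "final_state m U X t \<in> carrier_vec (2 ^ m)"
    using final_state_carrier[OF assms(1)] Suc.prems by simp
  have O: "unitary_mat (2 ^ m) (query_mat m X)"
    using assms unfolding query_mat_eq_perm_mat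
    by (intro unitary_perm_mat bij_betw_query_index) (simp add: quantum_network_def)
  then have "query_mat m X *\<^sub>v final_state m U X t \<in> carrier_vec (2 ^ m)"
    using v by (auto simp: unitary_mat_def)
  then show ?case
    using Suc assms(1) v by (simp add: unitary_mat_norm[OF O] unitary_mat_norm quantum_network_def)
qed

text \<open>The leading bits of the column number are the queried index, so only one input bit
  matters. If that index is \<open>N\<close> or more, the query fixes the basis state and the entry
  is constant.\<close>

lemma junta_sum_query_mat:
  assumes "r < 2 ^ m" "c < 2 ^ m"
  shows "junta_sum N 1 (\<lambda>X. query_mat m X $$ (r, c))"
proof (rule junta)
  show "depends_only_on N {c div 2 ^ (m - index_bits N - 1 + 1)} (\<lambda>X. query_mat m X $$ (r, c))"
    using assms by (auto simp: depends_only_on_def query_mat_def query_index_def Let_def)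
qed simp_all

text \<open>Each query raises the degree by at most one, while the unitaries only form linear
  combinations with coefficients independent of the input.\<close>

lemma junta_sum_final_state:
  assumes "quantum_network N m T U" "t \<le> T" "k < 2 ^ m"
  shows "junta_sum N t (\<lambda>X. final_state m U X t $ k)"
  using assms(2,3)
proof (induction t arbitrary: k)
  case 0
  then show ?case
    by (simp add: junta_sum_const)
next
  case (Suc t)
  have "U (Suc t) \<in> carrier_mat (2 ^ m) (2 ^ m)"
    using assms Suc.prems by (simp add: quantum_network_def unitary_mat_def)
  then have "final_state m U X (Suc t) $ k =
      (\<Sum>r<2 ^ m. U (Suc t) $$ (k, r) *
        (\<Sum>c<2 ^ m. query_mat m X $$ (r, c) * final_state m U X t $ c))" for X
    using Suc.prems final_state_carrier[OF assms(1), of t X]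
    by (simp add: scalar_prod_def lessThan_atLeast0 query_mat_eq_perm_mat perm_mat_def)
  moreover have "junta_sum N (1 + t) (\<lambda>X. query_mat m X $$ (r, c) * final_state m U X t $ c)"
    if "r < 2 ^ m" "c < 2 ^ m" for r c
    using that Suc by (intro junta_sum_mult junta_sum_query_mat) auto
  then have "junta_sum N (0 + (1 + t)) (\<lambda>X. \<Sum>r<2 ^ m. U (Suc t) $$ (k, r) *
      (\<Sum>c<2 ^ m. query_mat m X $$ (r, c) * final_state m U X t $ c))"
    by (intro junta_sum_sum junta_sum_mult[where d = 0] junta_sum_const) simp_all
  ultimately show ?case
    by simp
qed

text \<open>The probability is a sum of amplitudes times their conjugates, hence of degree at most
  \<open>T + T\<close>, which is below \<open>N\<close>.\<close>

lemma measure_prob_parity_orthogonal: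
  assumes "quantum_network N m T U" "2 * T < N"
  shows "(\<Sum>X | length X = N. (- 1) ^ count_list X True * measure_prob (final_state m U X T) P) = 0"
proof -
  define A where "A = {k. k < (2::nat) ^ m \<and> P k}"
  define p where "p X = measure_prob (final_state m U X T) P" for X
  have p: "complex_of_real (p X) =
      (\<Sum>k\<in>A. final_state m U X T $ k * cnj (final_state m U X T $ k))" for X
    unfolding p_def measure_prob_def of_real_sum complex_norm_square A_def
      carrier_vecD[OF final_state_carrier[OF assms(1) order_refl]] ..
  have "junta_sum N (T + T) (\<lambda>X. complex_of_real (p X))"
    unfolding p using assms(1)
    by (intro junta_sum_sum junta_sum_mult junta_sum_cnj junta_sum_final_state[OF assms(1)])
      (auto simp: A_def)
  then have "(\<Sum>X | length X = N. (- 1) ^ count_list X True * complex_of_real (p X)) = 0"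
    using assms(2) by (intro junta_sum_parity_orthogonal[where d = "T + T"]) simp_all
  then have "complex_of_real (\<Sum>X | length X = N. (- 1) ^ count_list X True * p X) = 0"
    by simp
  then show ?thesis
    unfolding p_def by (simp only: of_real_eq_0_iff)
qed

text \<open>If \<open>2 * T < N\<close>, both the probability and the constant \<open>a\<close> are
  orthogonal to the parity sign. But weighting by that sign reverses the inequality on odd inputs,
  so the weighted probability is strictly below the weighted constant everywhere, a
  contradiction.\<close>

lemma parity_separation_lower_bound:
  assumes "quantum_network N m T U"
    and odd: "\<And>X. length X = N \<Longrightarrow> odd (count_list X True) \<Longrightarrow>
      a < measure_prob (final_state m U X T) P"
    and even: "\<And>X. length X = N \<Longrightarrow> even (count_list X True) \<Longrightarrow>
      measure_prob (final_state m U X T) P < a"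
  shows "N \<le> 2 * T"
proof (rule ccontr)
  assume "\<not> N \<le> 2 * T"
  then have T: "2 * T < N"
    by simp
  define p where "p X = measure_prob (final_state m U X T) P" for X
  have "(\<Sum>X | length X = N. (- 1) ^ count_list X True * complex_of_real a) = 0"
    using T by (intro junta_sum_parity_orthogonal[OF junta_sum_const[where d = 0]]) simp
  then have "complex_of_real (\<Sum>X | length X = N. (- 1) ^ count_list X True * a) = 0"
    by simp
  then have a: "(\<Sum>X | length X = N. (- 1) ^ count_list X True * a) = 0"
    by (simp only: of_real_eq_0_iff)
  have "(\<Sum>X | length X = N. (- 1) ^ count_list X True * p X) <
      (\<Sum>X | length X = N. (- 1) ^ count_list X True * a)"
  proof (rule sum_strict_mono)
    show "finite {X :: bool list. length X = N}"
      using finite_lists_length_eq[of "UNIV :: bool set" N] by simp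
    show "{X :: bool list. length X = N} \<noteq> {}"
      using Ex_list_of_length by blast
    fix X assume "X \<in> {X :: bool list. length X = N}"
    then show "(- 1) ^ count_list X True * p X < (- 1) ^ count_list X True * a"
      using odd[of X] even[of X] by (cases "even (count_list X True)") (simp_all add: p_def)
  qed
  then show False
    using a measure_prob_parity_orthogonal[OF assms(1) T, of P] by (simp add: p_def)
qed

section \<open>Bounded-error and zero-error networks\<close>

lemma measure_prob_disj:
  assumes "\<And>k. \<not> (P k \<and> Q k)"
  shows "measure_prob v (\<lambda>k. P k \<or> Q k) = measure_prob v P + measure_prob v Q"
  unfolding measure_prob_def
  by (subst sum.union_disjoint[symmetric]) (use assms in \<open>auto intro!: sum.cong\<close>)

lemma measure_prob_final_state_UNIV:
  assumes "quantum_network N m T U" "length X = N"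
  shows "measure_prob (final_state m U X T) (\<lambda>k. True) = 1"
  using final_state_norm[OF assms(1) order_refl assms(2)] final_state_carrier[OF assms(1), of T X]
  by (simp add: measure_prob_def lessThan_def)

text \<open>Outcome 1 has probability at least 2/3 on odd inputs and at most 1/3 on even ones, so
  the threshold 1/2 separates them.\<close>

lemma bounded_error_lower_bound:
  assumes "quantum_network N m T U" "computes_bounded_error N m T U f"
    and f: "\<And>X. length X = N \<Longrightarrow> f X \<longleftrightarrow> odd (count_list X True)"
  shows "N \<le> 2 * T"
proof (rule parity_separation_lower_bound[OF assms(1), where a = "1 / 2" and P = "\<lambda>k. bit k 0"])
  fix X :: "bool list" assume X: "length X = N"
  let ?v = "final_state m U X T"
  have corr: "2 / 3 \<le> measure_prob ?v (\<lambda>k. bit k 0 = f X)"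
    using assms(2) X by (simp add: computes_bounded_error_def)
  show "1 / 2 < measure_prob ?v (\<lambda>k. bit k 0)" if "odd (count_list X True)"
    using corr f[OF X] that by simp
  show "measure_prob ?v (\<lambda>k. bit k 0) < 1 / 2" if "even (count_list X True)"
    using corr f[OF X] that measure_prob_final_state_UNIV[OF assms(1) X]
      measure_prob_disj[of "\<lambda>k. bit k 0" "\<lambda>k. \<not> bit k 0" ?v] by simp
qed

text \<open>The event of a conclusive answer 1 has probability 0 on even inputs and more than 1/2 on
  odd ones; 1/4 lies strictly between.\<close>

lemma zero_error_lower_bound:
  assumes "quantum_network N m T U" "computes_zero_error N m T U f"
    and f: "\<And>X. length X = N \<Longrightarrow> f X \<longleftrightarrow> odd (count_list X True)"
  shows "N \<le> 2 * T"
proof (rule parity_separation_lower_bound[OF assms(1), where a = "1 / 4"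
      and P = "\<lambda>k. bit k 1 \<and> bit k 0"])
  fix X :: "bool list" assume X: "length X = N"
  let ?v = "final_state m U X T"
  have wrong: "measure_prob ?v (\<lambda>k. bit k 1 \<and> bit k 0 \<noteq> f X) = 0"
    and inconclusive: "measure_prob ?v (\<lambda>k. \<not> bit k 1) < 1 / 2"
    using assms(2) X by (simp_all add: computes_zero_error_def)
  \<comment> \<open>The disjoint outcomes "inconclusive", "answer 0" and "answer 1" exhaust all
    basis states.\<close>
  have "(\<lambda>k::nat. (\<not> bit k 1 \<or> (bit k 1 \<and> \<not> bit k 0)) \<or> bit k 1 \<and> bit k 0) = (\<lambda>k. True)"
    by auto
  then have total: "measure_prob ?v (\<lambda>k. \<not> bit k 1) + measure_prob ?v (\<lambda>k. bit k 1 \<and> \<not> bit k 0) +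
      measure_prob ?v (\<lambda>k. bit k 1 \<and> bit k 0) = 1"
    using measure_prob_final_state_UNIV[OF assms(1) X]
      measure_prob_disj[of "\<lambda>k. \<not> bit k 1" "\<lambda>k. bit k 1 \<and> \<not> bit k 0" ?v]
      measure_prob_disj[of "\<lambda>k. \<not> bit k 1 \<or> (bit k 1 \<and> \<not> bit k 0)" "\<lambda>k. bit k 1 \<and> bit k 0" ?v]
    by simp
  show "1 / 4 < measure_prob ?v (\<lambda>k. bit k 1 \<and> bit k 0)" if "odd (count_list X True)"
    using wrong inconclusive total f[OF X] that by simp
  show "measure_prob ?v (\<lambda>k. bit k 1 \<and> bit k 0) < 1 / 4" if "even (count_list X True)"
    using wrong f[OF X] that by simp
qed

section \<open>A network for parity\<close>

text \<open>
  The character table of the group of order 4 and exponent 2, divided by 2, with its rows ordered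
  so that it is symmetric. Its columns 2 and 3 are the states
  \<open>(|0> \<plusminus> |1>) (|0> - |1>) / 2\<close>.
\<close>

definition character_entry :: "nat \<Rightarrow> nat \<Rightarrow> complex" where
  "character_entry i j = (if i = 0 \<or> j = 0 \<or> i = j then 1 / 2 else - 1 / 2)"

text \<open>The network has no work bits, so \<open>|i,b>\<close> has number
  \<open>2 * i + b\<close> and the block \<open>k div 4 = t\<close> collects the indices
  \<open>2 * t\<close> and \<open>2 * t + 1\<close>. The matrix applies the character table to each
  such block.\<close>

definition character_mat :: "nat \<Rightarrow> complex mat" where
  "character_mat d = mat d d
    (\<lambda>(r, c). if r div 4 = c div 4 then character_entry (r mod 4) (c mod 4) else 0)"

lemma character_mat_carrier [simp]: "character_mat d \<in> carrier_mat d d"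
  by (simp add: character_mat_def)

lemma col_character_mat_carrier [simp]: "col (character_mat d) c \<in> carrier_vec d"
  by (simp add: character_mat_def carrier_dim_vec)

lemma character_mat_symmetric:
  "i < d \<Longrightarrow> j < d \<Longrightarrow> character_mat d $$ (i, j) = character_mat d $$ (j, i)"
  by (simp add: character_mat_def character_entry_def)

lemma less_4_cases: "(r::nat) < 4 \<Longrightarrow> r = 0 \<or> r = 1 \<or> r = 2 \<or> r = 3"
  by linarith

lemma character_entry_orthogonal:
  assumes "i < 4" "j < 4"
  shows "(\<Sum>s<4. character_entry s i * character_entry s j) = (if i = j then 1 else 0)"
proof -
  have "(\<Sum>s<4. g s) = g 0 + g 1 + g 2 + g 3" for g :: "nat \<Rightarrow> complex"
    by (simp add: eval_nat_numeral)
  then show ?thesis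
    using less_4_cases[OF assms(1)] less_4_cases[OF assms(2)]
    by (elim disjE) (simp_all add: character_entry_def)
qed

lemma sum_block:
  fixes F :: "nat \<Rightarrow> 'a :: comm_monoid_add"
  assumes "4 * q + 4 \<le> d" "\<And>k. k < d \<Longrightarrow> k div 4 \<noteq> q \<Longrightarrow> F k = 0"
  shows "(\<Sum>k<d. F k) = (\<Sum>s<4. F (4 * q + s))"
proof -
  have "(\<Sum>k<d. F k) = (\<Sum>k\<in>(+) (4 * q) ` {..<4}. F k)"
  proof (rule sum.mono_neutral_right)
    show "\<forall>k\<in>{..<d} - (+) (4 * q) ` {..<4}. F k = 0"
    proof
      fix k assume k: "k \<in> {..<d} - (+) (4 * q) ` {..<4}"
      have "k = 4 * q + k mod 4" if "k div 4 = q"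
        using that by (metis mult_div_mod_eq)
      then have "k div 4 \<noteq> q"
        using k by (metis DiffE imageI lessThan_iff mod_less_divisor zero_less_numeral)
      then show "F k = 0"
        using k assms(2) by simp
    qed
  qed (use assms(1) in auto)
  then show ?thesis
    by (simp add: sum.reindex)
qed

text \<open>Columns of different blocks have disjoint supports; within one block the claim is that
  of the 4 by 4 table.\<close>

lemma character_mat_orthogonal:
  assumes "4 dvd d" "i < d" "j < d"
  shows "(\<Sum>k<d. character_mat d $$ (k, i) * character_mat d $$ (k, j)) = (if i = j then 1 else 0)"
proof -
  obtain e where e: "d = 4 * e"
    using assms(1) by (auto elim: dvdE)
  have q: "4 * (i div 4) + 4 \<le> d"
    using less_mult_imp_div_less[of i e 4] assms(2) e by (simp add: mult.commute)
  have less: "4 * (i div 4) + s < d" if "s < 4" for s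
    using that q by linarith
  have "(\<Sum>k<d. character_mat d $$ (k, i) * character_mat d $$ (k, j)) =
      (\<Sum>s<4. character_mat d $$ (4 * (i div 4) + s, i) * character_mat d $$ (4 * (i div 4) + s, j))"
    using q assms(2) by (intro sum_block) (simp_all add: character_mat_def)
  also have "\<dots> = (\<Sum>s<4. character_entry s (i mod 4) *
      (if i div 4 = j div 4 then character_entry s (j mod 4) else 0))"
    using less assms by (intro sum.cong) (simp_all add: character_mat_def)
  also have "\<dots> = (if i div 4 = j div 4 \<and> i mod 4 = j mod 4 then 1 else 0)"
    using character_entry_orthogonal[of "i mod 4" "j mod 4"] by (cases "i div 4 = j div 4") simp_all
  also have "\<dots> = (if i = j then 1 else 0)"
    by (metis mult_div_mod_eq)
  finally show ?thesis .
qed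

lemma unitary_character_mat:
  assumes "4 dvd d"
  shows "unitary_mat d (character_mat d)"
proof -
  have "cnj (character_mat d $$ (k, i)) = character_mat d $$ (k, i)" if "k < d" "i < d" for k i
    using that by (simp add: character_mat_def character_entry_def)
  then show ?thesis
    using character_mat_orthogonal[OF assms] by (simp add: unitary_mat_iff)
qed

lemma mult_unit_vec_eq_col:
  fixes A :: "'a :: comm_semiring_1 mat"
  assumes "A \<in> carrier_mat n d" "c < d"
  shows "A *\<^sub>v unit_vec d c = col A c"
  using assms by (intro eq_vecI) (auto simp: scalar_prod_right_unit)

text \<open>Being symmetric and orthogonal, the matrix is its own inverse. Hence it both prepares
  the superpositions and decodes them at the end.\<close>

lemma character_mat_mult_col:
  assumes "4 dvd d" "c < d"
  shows "character_mat d *\<^sub>v col (character_mat d) c = unit_vec d c"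
proof (rule eq_vecI)
  fix i assume i: "i < dim_vec (unit_vec d c :: complex vec)"
  then have "(character_mat d *\<^sub>v col (character_mat d) c) $ i =
      (\<Sum>k<d. character_mat d $$ (i, k) * character_mat d $$ (k, c))"
    using assms carrier_matD[OF character_mat_carrier, of d]
    by (simp add: scalar_prod_def lessThan_atLeast0)
  also have "\<dots> = (\<Sum>k<d. character_mat d $$ (k, i) * character_mat d $$ (k, c))"
    using i by (intro sum.cong) (simp_all add: character_mat_symmetric)
  also have "\<dots> = unit_vec d c $ i"
    using i assms character_mat_orthogonal by simp
  finally show "(character_mat d *\<^sub>v col (character_mat d) c) $ i = unit_vec d c $ i" .
qed (simp add: character_mat_def)

lemma col_character_mat_index:
  "c < d \<Longrightarrow> k < d \<Longrightarrow> col (character_mat d) c $ k =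
    (if k div 4 = c div 4 then character_entry (k mod 4) (c mod 4) else 0)"
  by (simp add: character_mat_def)

section \<open>Cyclic shifts of the basis states\<close>

lemma bij_betw_shift:
  assumes "a \<le> (d::nat)"
  shows "bij_betw (\<lambda>k. (k + a) mod d) {..<d} {..<d}"
proof (cases "d = 0")
  case False
  \<comment> \<open>The inverse is the shift by \<open>d - a\<close>.\<close>
  have "((k + a) mod d + (d - a)) mod d = k" "((k + (d - a)) mod d + a) mod d = k" if "k < d" for k
    using that assms by (cases "k + a < d"; cases "k < a"; simp add: le_mod_geq)+
  then show ?thesis
    using False by (intro bij_betw_byWitness[where f' = "\<lambda>k. (k + (d - a)) mod d"]) auto
qed (simp add: bij_betw_def)

definition shift_mat :: "nat \<Rightarrow> nat \<Rightarrow> complex mat" where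
  "shift_mat d a = perm_mat d (\<lambda>k. (k + a) mod d)"

lemma shift_mat_carrier [simp]: "shift_mat d a \<in> carrier_mat d d"
  by (simp add: shift_mat_def)

lemma unitary_shift_mat: "a \<le> d \<Longrightarrow> unitary_mat d (shift_mat d a)"
  unfolding shift_mat_def by (intro unitary_perm_mat bij_betw_shift)

lemma shift_mat_mult_unit_vec_0:
  assumes "a < d"
  shows "shift_mat d a *\<^sub>v unit_vec d 0 = unit_vec d a"
  unfolding shift_mat_def
proof (rule perm_mat_mult_vec_eqI[OF bij_betw_shift])
  fix k assume "k < d"
  then have "(k + a) mod d = a \<longleftrightarrow> k = 0"
    using assms by (cases "k + a < d") (auto simp: le_mod_geq)
  then show "(unit_vec d a :: complex vec) $ ((k + a) mod d) = unit_vec d 0 $ k"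
    using assms \<open>k < d\<close> by (simp add: unit_vec_def)
qed (use assms in simp_all)

text \<open>A shift by 4 moves each block to the next one and keeps positions inside the
  block.\<close>

lemma shift_mat_mult_col_character_mat:
  assumes "4 dvd d" "c + 4 < d"
  shows "shift_mat d 4 *\<^sub>v col (character_mat d) c = col (character_mat d) (c + 4)"
  unfolding shift_mat_def
proof (rule perm_mat_mult_vec_eqI[OF bij_betw_shift])
  fix k assume k: "k < d"
  obtain e where e: "d = 4 * e"
    using assms(1) by (auto elim: dvdE)
  show "col (character_mat d) (c + 4) $ ((k + 4) mod d) = col (character_mat d) c $ k"
  proof (cases "k + 4 < d")
    case True
    then show ?thesis
      using assms(2) k by (simp add: col_character_mat_index)
  next
    \<comment> \<open>Wraparound: \<open>k\<close> is in the last block and its image in block 0,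
      while \<open>c\<close> lies before the last block and \<open>c + 4\<close> after block 0. Both
      entries are therefore 0.\<close>
    case False
    then have "(k + 4) mod d = k + 4 - d"
      using k assms(2) by (simp add: le_mod_geq)
    moreover have "(k + 4 - d) div 4 \<noteq> (c + 4) div 4"
      using k by simp
    moreover have "c div 4 < e - 1" "e - 1 \<le> k div 4"
      using assms(2) False e by (simp_all add: div_less_iff_less_mult less_eq_div_iff_mult_less_eq)
    moreover have "k + 4 - d < d"
      using k assms(2) by linarith
    ultimately show ?thesis
      using assms(2) k by (simp add: col_character_mat_index)
  qed
qed (use assms in simp_all)

lemma flip_bit_0_nat: "flip_bit 0 (k::nat) = (if even k then k + 1 else k - 1)"
  by (cases "even k") (auto simp: flip_bit_0 elim!: evenE oddE)

text \<open>
  The pair of coordinates \<open>2 * t\<close>, \<open>2 * t + 1\<close> is queried in superposition, with the target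
  qubit in the state \<open>(|0> - |1>) / sqrt 2\<close>: the first one becomes a global sign and the parity
  of the pair is added to the relative sign.
\<close>

lemma query_mat_mult_col_character_mat:
  fixes X :: "bool list" and p :: bool
  defines "m \<equiv> index_bits (length X) + 1"
  assumes "2 * t + 1 < length X" "4 * t + 4 \<le> 2 ^ m"
  shows "query_mat m X *\<^sub>v col (character_mat (2 ^ m)) (4 * t + 2 + of_bool p) =
    (if X ! (2 * t) then - 1 else 1) \<cdot>\<^sub>v
      col (character_mat (2 ^ m)) (4 * t + 2 + of_bool (p \<noteq> (X ! (2 * t) \<noteq> X ! (2 * t + 1))))"
  unfolding query_mat_eq_perm_mat
proof (rule perm_mat_mult_vec_eqI)
  let ?W = "character_mat (2 ^ m)" and ?q = "query_index m X"
  let ?p' = "p \<noteq> (X ! (2 * t) \<noteq> X ! (2 * t + 1))"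
  fix k :: nat assume k: "k < 2 ^ m"
  \<comment> \<open>Here \<open>w = 0\<close>: the target qubit is the lowest bit and the index is
    \<open>k div 2\<close>.\<close>
  have q: "?q k = (if k div 2 < length X \<and> X ! (k div 2) then if even k then k + 1 else k - 1 else k)"
    by (simp add: query_index_def Let_def m_def flip_bit_0_nat)
  have qk: "?q k < 2 ^ m"
    using k by (intro query_index_less) (simp_all add: m_def)
  have "?q k div 4 = k div 4"
    unfolding q by (cases "even k") (auto elim!: evenE oddE)
  moreover have mod_4: "(4 * t + a) mod 4 = a" if "a < 4" for a
    using that by simp
  moreover have "character_entry (k mod 4) (2 + of_bool p) =
      (if X ! (2 * t) then - 1 else 1) * character_entry (?q k mod 4) (2 + of_bool ?p')"
    if "k div 4 = t"
  proof -
    have "k = 4 * t + k mod 4"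
      using that by (metis mult_div_mod_eq)
    \<comment> \<open>The four basis states of the block: two for each index, one per value of the
      target qubit.\<close>
    then consider "k = 4 * t + 0" | "k = 4 * t + 1" | "k = 4 * t + 2" | "k = 4 * t + 3"
      using less_4_cases[of "k mod 4"] by force
    then show ?thesis
    proof cases
      case 1
      then have "k div 2 = 2 * t" "even k"
        by presburger+
      then have "?q k = (if X ! (2 * t) then k + 1 else k)"
        using assms(2) unfolding q by simp
      then have "?q k = 4 * t + (if X ! (2 * t) then 1 else 0)"
        using 1 by simp
      then have q_mod: "?q k mod 4 = (if X ! (2 * t) then 1 else 0)"
        by (simp only:) (rule mod_4, simp)
      have k_mod: "k mod 4 = 0"
        unfolding 1 by (rule mod_4) simp
      show ?thesis
        unfolding q_mod k_mod character_entry_def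
        by (cases p; cases "X ! (2 * t)"; cases "X ! (2 * t + 1)") simp_all
    next
      case 2
      then have "k div 2 = 2 * t" "odd k"
        by presburger+
      then have "?q k = (if X ! (2 * t) then k - 1 else k)"
        using assms(2) unfolding q by simp
      then have "?q k = 4 * t + (if X ! (2 * t) then 0 else 1)"
        using 2 by simp
      then have q_mod: "?q k mod 4 = (if X ! (2 * t) then 0 else 1)"
        by (simp only:) (rule mod_4, simp)
      have k_mod: "k mod 4 = 1"
        unfolding 2 by (rule mod_4) simp
      show ?thesis
        unfolding q_mod k_mod character_entry_def
        by (cases p; cases "X ! (2 * t)"; cases "X ! (2 * t + 1)") simp_all
    next
      case 3
      then have "k div 2 = 2 * t + 1" "even k"
        by presburger+
      then have "?q k = (if X ! (2 * t + 1) then k + 1 else k)"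
        using assms(2) unfolding q by simp
      then have "?q k = 4 * t + (if X ! (2 * t + 1) then 3 else 2)"
        using 3 by simp
      then have q_mod: "?q k mod 4 = (if X ! (2 * t + 1) then 3 else 2)"
        by (simp only:) (rule mod_4, simp)
      have k_mod: "k mod 4 = 2"
        unfolding 3 by (rule mod_4) simp
      show ?thesis
        unfolding q_mod k_mod character_entry_def
        by (cases p; cases "X ! (2 * t)"; cases "X ! (2 * t + 1)") simp_all
    next
      case 4
      then have "k div 2 = 2 * t + 1" "odd k"
        by presburger+
      then have "?q k = (if X ! (2 * t + 1) then k - 1 else k)"
        using assms(2) unfolding q by simp
      then have "?q k = 4 * t + (if X ! (2 * t + 1) then 2 else 3)"
        using 4 by simp
      then have q_mod: "?q k mod 4 = (if X ! (2 * t + 1) then 2 else 3)"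
        by (simp only:) (rule mod_4, simp)
      have k_mod: "k mod 4 = 3"
        unfolding 4 by (rule mod_4) simp
      show ?thesis
        unfolding q_mod k_mod character_entry_def
        by (cases p; cases "X ! (2 * t)"; cases "X ! (2 * t + 1)") simp_all
    qed
  qed
  moreover have "(4 * t + 2 + of_bool b) div 4 = t" "(4 * t + 2 + of_bool b) mod 4 = 2 + of_bool b" for b
    by (cases b; simp only: of_bool_eq; presburger)+
  moreover have "4 * t + 2 + of_bool b < (2::nat) ^ m" for b
    using assms(3) by (cases b) simp_all
  ultimately show "((if X ! (2 * t) then - 1 else 1) \<cdot>\<^sub>v col ?W (4 * t + 2 + of_bool ?p')) $ ?q k =
      col ?W (4 * t + 2 + of_bool p) $ k"
    using k qk carrier_matD[OF character_mat_carrier, of "2 ^ m"]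
    by (simp only: index_smult_vec dim_col col_character_mat_index) simp
qed (use bij_betw_query_index[of X m] in \<open>simp_all add: m_def\<close>)

text \<open>The first unitary turns \<open>|0>\<close> into number 2 and then into column 2, the
  even state of block 0. The middle ones advance to the next pair of indices, and the last one
  decodes.\<close>

definition parity_network :: "nat \<Rightarrow> nat \<Rightarrow> nat \<Rightarrow> complex mat" where
  "parity_network d T j =
    (if j = 0 then character_mat d * shift_mat d 2 else if j = T then character_mat d else shift_mat d 4)"

lemma unitary_parity_network:
  assumes "4 dvd d" "4 \<le> d"
  shows "unitary_mat d (parity_network d T j)"
  using assms
  by (simp add: parity_network_def unitary_mat_mult unitary_character_mat unitary_shift_mat)

lemma count_list_take_two_more:
  assumes "2 * t + 1 < length X"
  shows "odd (count_list (take (2 * Suc t) X) True) \<longleftrightarrow>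
    odd (count_list (take (2 * t) X) True) \<noteq> (X ! (2 * t) \<noteq> X ! (2 * t + 1))"
  using assms by (simp add: take_Suc_conv_app_nth)

text \<open>One query extends the recorded parity from \<open>2 * t\<close> bits to
  \<open>2 * Suc t\<close> bits. The global sign does not affect measurements, so only its being 1
  or -1 is kept.\<close>

lemma query_mat_mult_col_sign:
  fixes X :: "bool list" and c :: complex
  defines "m \<equiv> index_bits (length X) + 1"
  assumes "2 * t + 1 < length X" "4 * t + 4 \<le> 2 ^ m" "c \<in> {1, - 1}"
  obtains c' where "c' \<in> {1, - 1}"
    "query_mat m X *\<^sub>v
      (c \<cdot>\<^sub>v col (character_mat (2 ^ m)) (4 * t + 2 + of_bool (odd (count_list (take (2 * t) X) True)))) =
     c' \<cdot>\<^sub>v col (character_mat (2 ^ m)) (4 * t + 2 + of_bool (odd (count_list (take (2 * Suc t) X) True)))"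
proof
  let ?s = "if X ! (2 * t) then - 1 else 1 :: complex"
  show "c * ?s \<in> {1, - 1}"
    using assms(4) by auto
  have O: "query_mat m X \<in> carrier_mat (2 ^ m) (2 ^ m)"
    by (simp add: query_mat_def)
  show "query_mat m X *\<^sub>v
      (c \<cdot>\<^sub>v col (character_mat (2 ^ m)) (4 * t + 2 + of_bool (odd (count_list (take (2 * t) X) True)))) =
     (c * ?s) \<cdot>\<^sub>v col (character_mat (2 ^ m)) (4 * t + 2 + of_bool (odd (count_list (take (2 * Suc t) X) True)))"
    unfolding mult_mat_vec[OF O col_character_mat_carrier] count_list_take_two_more[OF assms(2)]
      query_mat_mult_col_character_mat[OF assms(2) assms(3)[unfolded m_def], folded m_def]
      smult_smult_assoc ..
qed

text \<open>The invariant of the run: after \<open>t\<close> queries and the unitary that follows,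
  the state sits on block \<open>t\<close>, and the choice between its columns 2 and 3 records the
  parity of the bits read so far.\<close>

lemma parity_network_before_query:
  fixes X :: "bool list"
  defines "m \<equiv> index_bits (length X) + 1"
  assumes "4 dvd (2::nat) ^ m" "2 * length X \<le> 2 ^ m" "2 * T \<le> length X" "t < T"
  shows "\<exists>c\<in>{1, - 1}. final_state m (parity_network (2 ^ m) T) X t =
    c \<cdot>\<^sub>v col (character_mat (2 ^ m)) (4 * t + 2 + of_bool (odd (count_list (take (2 * t) X) True)))"
  using assms(5)
proof (induction t)
  case 0
  have "4 \<le> (2::nat) ^ m"
    using assms(2) by (simp add: dvd_imp_le)
  then have "final_state m (parity_network (2 ^ m) T) X 0 = col (character_mat (2 ^ m)) 2"
    using assoc_mult_mat_vec[OF character_mat_carrier shift_mat_carrier unit_vec_carrier]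
      mult_unit_vec_eq_col[OF character_mat_carrier]
    by (simp add: parity_network_def shift_mat_mult_unit_vec_0)
  moreover have "4 * 0 + 2 + of_bool (odd (count_list (take (2 * 0) X) True)) = (2::nat)"
    by simp
  ultimately show ?case
    by (intro bexI[of _ 1]) (simp_all only: one_smult_vec insertI1)
next
  case (Suc t)
  let ?W = "character_mat (2 ^ m)"
  let ?c = "\<lambda>t. 4 * t + 2 + of_bool (odd (count_list (take (2 * t) X) True)) :: nat"
  obtain c :: complex where c: "c \<in> {1, - 1}"
    and IH: "final_state m (parity_network (2 ^ m) T) X t = c \<cdot>\<^sub>v col ?W (?c t)"
    using Suc.IH[OF Suc_lessD[OF Suc.prems]] by blast
  have t: "2 * t + 1 < length X" "4 * t + 4 \<le> 2 ^ m" "4 * t + 4 + 4 \<le> 2 ^ m"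
    using Suc.prems assms(3,4) by linarith+
  obtain c' :: complex where c': "c' \<in> {1, - 1}" and
    query: "query_mat m X *\<^sub>v (c \<cdot>\<^sub>v col ?W (?c t)) =
      c' \<cdot>\<^sub>v col ?W (4 * t + 2 + of_bool (odd (count_list (take (2 * Suc t) X) True)))"
    using query_mat_mult_col_sign[OF t(1) t(2)[unfolded m_def] c, folded m_def] by blast
  \<comment> \<open>As \<open>Suc t < T\<close>, there is a further block to move to, so the shift
    does not wrap around.\<close>
  have next_index: "4 * t + 2 + of_bool b + 4 = 4 * Suc t + 2 + of_bool b"
    "4 * t + 2 + of_bool b + 4 < (2::nat) ^ m" for b
    using t(3) by (cases b; simp)+
  have "final_state m (parity_network (2 ^ m) T) X (Suc t) =
      shift_mat (2 ^ m) 4 *\<^sub>v (query_mat m X *\<^sub>v (c \<cdot>\<^sub>v col ?W (?c t)))"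
    using Suc.prems by (simp add: parity_network_def IH)
  also have "\<dots> = c' \<cdot>\<^sub>v col ?W (?c (Suc t))"
    unfolding query mult_mat_vec[OF shift_mat_carrier col_character_mat_carrier]
      shift_mat_mult_col_character_mat[OF assms(2) next_index(2)] next_index(1) ..
  finally show ?case
    using c' by blast
qed

lemma measure_prob_unit_vec:
  assumes "i < d" "cmod c = 1"
  shows "measure_prob (c \<cdot>\<^sub>v unit_vec d i) P = of_bool (P i)"
proof -
  have "measure_prob (c \<cdot>\<^sub>v unit_vec d i) P = (\<Sum>k\<in>{k. k < d \<and> P k}. if k = i then 1 else 0)"
    unfolding measure_prob_def using assms by (intro sum.cong) (auto simp: norm_mult)
  then show ?thesis
    using assms(1) by simp
qed

text \<open>After the last query all bits have been read, and the self-inverse character matrix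
  turns the column into the basis state with its number.\<close>

lemma parity_network_final_state:
  fixes X :: "bool list"
  defines "m \<equiv> index_bits (length X) + 1"
  assumes "4 dvd (2::nat) ^ m" "2 * length X \<le> 2 ^ m" "2 * T = length X" "0 < T"
  shows "\<exists>c\<in>{1, - 1}. final_state m (parity_network (2 ^ m) T) X T =
    c \<cdot>\<^sub>v unit_vec (2 ^ m) (4 * (T - 1) + 2 + of_bool (odd (count_list X True)))"
proof -
  obtain t where T: "T = Suc t"
    using assms(5) by (cases T) simp_all
  let ?W = "character_mat (2 ^ m)"
  let ?p = "odd (count_list (take (2 * t) X) True)"
  have t: "2 * t + 1 < length X" "4 * t + 4 \<le> 2 ^ m"
    using assms(3,4) T by linarith+
  obtain c :: complex where c: "c \<in> {1, - 1}"
    and before: "final_state m (parity_network (2 ^ m) T) X t = c \<cdot>\<^sub>v col ?W (4 * t + 2 + of_bool ?p)"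
    using parity_network_before_query[of X T t, folded m_def, OF assms(2,3) eq_imp_le[OF assms(4)]] T
    by blast
  obtain c' :: complex where c': "c' \<in> {1, - 1}" and
    query: "query_mat m X *\<^sub>v (c \<cdot>\<^sub>v col ?W (4 * t + 2 + of_bool ?p)) =
      c' \<cdot>\<^sub>v col ?W (4 * t + 2 + of_bool (odd (count_list (take (2 * Suc t) X) True)))"
    using query_mat_mult_col_sign[OF t(1) t(2)[unfolded m_def] c, folded m_def] by blast
  have all: "take (2 * Suc t) X = X"
    using assms(4) T by simp
  have less: "4 * t + 2 + of_bool b < (2::nat) ^ m" for b
    using t(2) by (cases b) simp_all
  have "final_state m (parity_network (2 ^ m) T) X T =
      ?W *\<^sub>v (query_mat m X *\<^sub>v (c \<cdot>\<^sub>v col ?W (4 * t + 2 + of_bool ?p)))"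
    using before by (simp add: parity_network_def T)
  also have "\<dots> = c' \<cdot>\<^sub>v unit_vec (2 ^ m) (4 * t + 2 + of_bool (odd (count_list X True)))"
    unfolding query all mult_mat_vec[OF character_mat_carrier col_character_mat_carrier]
      character_mat_mult_col[OF assms(2) less] ..
  finally show ?thesis
    using c' unfolding T diff_Suc_1 by blast
qed

text \<open>Guarantees that the blocks of all pairs of indices fit into the register.\<close>

lemma le_two_power_index_bits: "N \<le> 2 ^ index_bits N"
proof (cases "N = 0")
  case False
  have "log 2 (real N) \<le> real (index_bits N)"
    unfolding index_bits_def by linarith
  then have "real N \<le> 2 powr real (index_bits N)"
    using False by (simp add: log_le_iff)
  then have "real N \<le> real (2 ^ index_bits N)"
    by (simp add: powr_realpow)
  then show ?thesis
    by (simp only: of_nat_le_iff)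
qed simp

text \<open>One network serves both modes: up to sign it ends in a basis state whose lowest bit is
  the parity and whose next bit always says "conclusive".\<close>

lemma parity_network_correct:
  assumes "N \<ge> 2" "even N"
    and f: "\<And>X. length X = N \<Longrightarrow> f X \<longleftrightarrow> odd (count_list X True)"
  shows "\<exists>m U. quantum_network N m (N div 2) U \<and>
    computes_exactly N m (N div 2) U f \<and> computes_zero_error N m (N div 2) U f"
proof -
  define m where "m = index_bits N + 1"
  define T where "T = N div 2"
  define U where "U = parity_network (2 ^ m) T"
  have T: "2 * T = N" "0 < T"
    using assms(1,2) by (simp_all add: T_def)
  have le: "2 * N \<le> 2 ^ m"
    using le_two_power_index_bits[of N] by (simp add: m_def)
  \<comment> \<open>\<open>N \<ge> 2\<close> forces an index qubit, so the dimension is a multiple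
    of the block size 4.\<close>
  have "index_bits N \<noteq> 0"
    using le_two_power_index_bits[of N] assms(1) by (cases "index_bits N = 0") simp_all
  then have m: "2 \<le> m"
    by (simp add: m_def)
  then have dvd: "4 dvd (2::nat) ^ m"
    using le_imp_power_dvd[of 2 m "2::nat"] by simp
  have prob: "measure_prob (final_state m U X T) P =
      of_bool (P (4 * (T - 1) + 2 + of_bool (f X)))" if X: "length X = N" for X P
  proof -
    obtain c :: complex where c: "c \<in> {1, - 1}" and
      "final_state m U X T = c \<cdot>\<^sub>v unit_vec (2 ^ m) (4 * (T - 1) + 2 + of_bool (f X))"
      using parity_network_final_state[of X T] dvd le T unfolding X f[OF X] U_def m_def by blast
    moreover have "4 * (T - 1) + 2 + of_bool (f X) < (2::nat) ^ m"
      using le T by (cases "f X") auto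
    moreover have "cmod c = 1"
      using c by auto
    ultimately show ?thesis
      by (simp only: measure_prob_unit_vec)
  qed
  \<comment> \<open>The offset 2 from using columns 2 and 3 is precisely the conclusive bit.\<close>
  have "bit (4 * q + 2 + of_bool b) 0 = b" "bit (4 * q + 2 + of_bool b) 1" for q :: nat and b
    by (cases b; simp add: bit_iff_odd)+
  then have "computes_exactly N m T U f" "computes_zero_error N m T U f"
    using m by (simp_all add: computes_exactly_def computes_zero_error_def prob del: One_nat_def)
  moreover have "quantum_network N m T U"
    using dvd dvd_imp_le[OF dvd]
    by (simp add: quantum_network_def m_def U_def unitary_parity_network)
  ultimately show ?thesis
    unfolding T_def by blast
qed

section \<open>The three query complexities\<close>

lemma computes_exactly_imp_bounded_error:
  "computes_exactly N m T U f \<Longrightarrow> computes_bounded_error N m T U f"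
  by (simp add: computes_exactly_def computes_bounded_error_def)

lemma Inf_enat_eqI:
  fixes P :: "nat \<Rightarrow> bool"
  assumes "P n" "\<And>k. P k \<Longrightarrow> n \<le> k"
  shows "Inf {enat k | k. P k} = enat n"
  by (rule antisym) (use assms in \<open>auto intro!: Inf_lower Inf_greatest\<close>)

theorem proposition6p4:
  fixes N :: nat and f :: "bool list \<Rightarrow> bool"
  assumes "N \<ge> 2" and "even N"
    and "\<And>X. length X = N \<Longrightarrow> f X \<longleftrightarrow> odd (count_list X True)"
  shows "Q_E N f = enat (N div 2) \<and> Q_0 N f = enat (N div 2) \<and> Q_2 N f = enat (N div 2)"
proof -
  note upper = parity_network_correct[OF assms]
  have bounded: "N div 2 \<le> T"
    if "quantum_network N m T U" "computes_bounded_error N m T U f" for m T U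
    using bounded_error_lower_bound[OF that assms(3)] by linarith
  have zero: "N div 2 \<le> T"
    if "quantum_network N m T U" "computes_zero_error N m T U f" for m T U
    using zero_error_lower_bound[OF that assms(3)] by linarith
  \<comment> \<open>An exact network is also a bounded-error one, so it inherits the bounded-error
    lower bound; conversely, the exact network above bounds \<open>Q_2\<close>.\<close>
  have "Q_E N f = enat (N div 2)"
    unfolding Q_E_def
    by (rule Inf_enat_eqI) (use upper bounded computes_exactly_imp_bounded_error in blast)+
  moreover have "Q_0 N f = enat (N div 2)"
    unfolding Q_0_def by (rule Inf_enat_eqI) (use upper zero in blast)+
  moreover have "Q_2 N f = enat (N div 2)"
    unfolding Q_2_def
    by (rule Inf_enat_eqI) (use upper bounded computes_exactly_imp_bounded_error in blast)+
  ultimately show ?thesis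
    by simp
qed

end
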